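(* Let $G=(V,E)$ be a finite connected graph with a group of automorphisms $\Psi\le\mathrm{Aut}(G)$, let $\lambda$ be a Laplacian eigenvalue of $G$, and let $\mathcal{E}_\lambda=X_1\oplus\cdots\oplus X_h$ be the isotypic decomposition of $\mathcal{E}_\lambda$ as a real $\Psi$-representation. Suppose each isotypic component $X_j$ has multiplicity $1$ (i.e. each $X_j$ is itself irreducible), and fix a nonzero $\varphi_j\in X_j$ for each $1\le j\le h$. Then $\ell_\Psi(\mathcal{E}_\lambda)=\{\ell_\Psi(\varphi):\varphi\in\mathcal{E}_\lambda\}$ is a polyhedral cone given by $$\ell_\Psi(\mathcal{E}_\lambda)=\mathrm{Cone}\{\ell_\Psi(\varphi_j):1\le j\le h\}.$$
   Context: $G=(V,E)$ is a finite, connected, simple undirected graph. Its Laplacian $L$ is the symmetric matrix with $\langle\varphi,L\varphi\rangle=\sum_{uv\in E}(\varphi(u)-\varphi(v))^2$ for $\varphi\in\mathbb{R}^V$, and $\mathcal{E}_\lambda=\{\varphi\in\mathbb{R}^V:L\varphi=\lambda\varphi\}$. The group $\Psi$ acts on $\mathbb{R}^V$ by $(\sigma\cdot\varphi)(u)=\varphi(\sigma^{-1}(u))$; each $\mathcal{E}_\lambda$ is a subrepresentation. In the isotypic decomposition each $X_j$ is isomorphic to $U_j\otimes\mathbb{R}^{m_j}$ (trivial action on $\mathbb{R}^{m_j}$) with the $U_j$ pairwise non-isomorphic real irreducible representations; $m_j$ is the multiplicity. Let $\mathcal{O}_1,\dots,\mathcal{O}_s$ be the orbits of $\Psi$ on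 the edge set $E$. For $\varphi:V\to\mathbb{R}$, $\ell_\Psi(\varphi)=\big(\sum_{uv\in\mathcal{O}_i}(\varphi(u)-\varphi(v))^2\big)_{i=1}^s\in\mathbb{R}^s$. $\mathrm{Cone}(S)$ denotes the set of all finite nonnegative linear combinations of elements of $S$. *)

theory Defs
  imports "HOL-Analysis.Analysis" "HOL-Algebra.Group" "HOL-Library.Function_Algebras"
begin

section \<open>Graphs, automorphisms and the Laplacian\<close>

text \<open>The vertex set is a finite type \<open>'v\<close>; edges are two-element sets of vertices.\<close>

definition simple_graph :: "'v set set \<Rightarrow> bool"
  where "simple_graph E \<longleftrightarrow> (\<forall>e\<in>E. card e = 2)"

definition connected_graph :: "'v set set \<Rightarrow> bool"
  where "connected_graph E \<longleftrightarrow> (\<forall>u v. (u, v) \<in> {(a, b). {a, b} \<in> E}\<^sup>*)"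

definition aut_group :: "'v set set \<Rightarrow> ('v \<Rightarrow> 'v) monoid"
  where "aut_group E =
    \<lparr>carrier = {\<sigma>. bij \<sigma> \<and> (\<forall>u v. {\<sigma> u, \<sigma> v} \<in> E \<longleftrightarrow> {u, v} \<in> E)}, mult = (\<circ>), one = id\<rparr>"

definition edge_sq :: "real ^ 'v \<Rightarrow> 'v set \<Rightarrow> real"
  where "edge_sq \<phi> e = (THE d. \<exists>u v. e = {u, v} \<and> d = (\<phi> $ u - \<phi> $ v)\<^sup>2)"

lemma edge_sq_doubleton: "edge_sq \<phi> {u, v} = (\<phi> $ u - \<phi> $ v)\<^sup>2"
  unfolding edge_sq_def
  by (rule the_equality) (auto simp: doubleton_eq_iff power2_commute)

definition is_laplacian :: "('v::finite) set set \<Rightarrow> real ^ 'v ^ 'v \<Rightarrow> bool"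
  where "is_laplacian E L \<longleftrightarrow>
    transpose L = L \<and> (\<forall>\<phi>. \<phi> \<bullet> (L *v \<phi>) = (\<Sum>e\<in>E. edge_sq \<phi> e))"

definition laplacian :: "('v::finite) set set \<Rightarrow> real ^ 'v ^ 'v"
  where "laplacian E = (THE L. is_laplacian E L)"

lemma is_laplacian_laplacian:
  fixes E :: "('v::finite) set set"
  assumes "simple_graph E"
  shows "is_laplacian E (laplacian E)"
proof -
  have ex: "\<exists>L. is_laplacian E L"
    using finite[of E] assms
  proof (induction E rule: finite_induct)
    case empty
    show ?case
      by (rule exI[of _ 0]) (simp add: is_laplacian_def transpose_def vec_eq_iff)
  next
    case (insert e F)
    then obtain L where L: "is_laplacian F L" by (auto simp: simple_graph_def)
    obtain a b where e: "e = {a, b}"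
      using insert.prems by (auto simp: simple_graph_def card_2_iff)
    define w :: "real ^ 'v" where "w = axis a 1 - axis b 1"
    define B :: "real ^ 'v ^ 'v" where "B = (\<chi> i j. w $ i * w $ j)"
    have Bmul: "B *v \<phi> = (w \<bullet> \<phi>) *\<^sub>R w" for \<phi>
      by (simp add: vec_eq_iff B_def matrix_vector_mult_def inner_vec_def sum_distrib_left
          sum_distrib_right mult_ac)
    have w: "w \<bullet> \<phi> = \<phi> $ a - \<phi> $ b" for \<phi>
      by (simp add: w_def inner_diff_left inner_axis inner_commute[of "axis _ _"])
    have "\<phi> \<bullet> (B *v \<phi>) = edge_sq \<phi> e" for \<phi>
      by (simp add: Bmul e edge_sq_doubleton power2_eq_square w inner_commute[of \<phi> w])
    moreover have "transpose B = B"
      by (simp add: transpose_def B_def vec_eq_iff mult.commute)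
    ultimately have "is_laplacian (insert e F) (B + L)"
      using L insert.hyps
      by (simp add: is_laplacian_def matrix_vector_mult_add_rdistrib inner_add_right
          transpose_def vec_eq_iff)
    then show ?case ..
  qed
  have uniq: "L = M" if LM: "is_laplacian E L" "is_laplacian E M" for L M
  proof -
    define A where "A = L - M"
    have Amul: "A *v x = L *v x - M *v x" for x
      by (simp add: A_def matrix_vector_mult_diff_rdistrib)
    have q: "x \<bullet> (A *v x) = 0" for x
      using LM by (simp add: is_laplacian_def Amul inner_diff_right)
    have "transpose A = A"
      using LM by (simp add: is_laplacian_def A_def transpose_def vec_eq_iff)
    then have sym: "x \<bullet> (A *v y) = y \<bullet> (A *v x)" for x y
      by (metis dot_lmul_matrix inner_commute transpose_matrix_vector)
    have "x \<bullet> (A *v y) = 0" for x y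
      using q[of "x + y"] q[of x] q[of y] sym[of x y]
      by (simp add: matrix_vector_right_distrib inner_add_left inner_add_right)
    then have "A *v y = 0" for y
      using inner_eq_zero_iff by blast
    then have "A = 0"
      by (simp add: matrix_eq)
    then show "L = M" by (simp add: A_def)
  qed
  show ?thesis
    unfolding laplacian_def using ex uniq by (metis theI)
qed

definition eigenspace :: "('v::finite) set set \<Rightarrow> real \<Rightarrow> (real ^ 'v) set"
  where "eigenspace E \<mu> = {\<phi>. laplacian E *v \<phi> = \<mu> *\<^sub>R \<phi>}"

definition laplacian_eigenvalue :: "('v::finite) set set \<Rightarrow> real \<Rightarrow> bool"
  where "laplacian_eigenvalue E \<mu> \<longleftrightarrow> (\<exists>\<phi>. \<phi> \<noteq> 0 \<and> laplacian E *v \<phi> = \<mu> *\<^sub>R \<phi>)"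


section \<open>Real representations\<close>

instantiation "fun" :: (type, real_vector) real_vector
begin

definition scaleR_fun :: "real \<Rightarrow> ('a \<Rightarrow> 'b) \<Rightarrow> 'a \<Rightarrow> 'b"
  where "scaleR_fun c f = (\<lambda>x. c *\<^sub>R f x)"

instance
  by standard (simp_all add: fun_eq_iff scaleR_fun_def algebra_simps)

end

definition linear_on :: "'a::real_vector set \<Rightarrow> ('a \<Rightarrow> 'b::real_vector) \<Rightarrow> bool"
  where "linear_on W f \<longleftrightarrow>
    (\<forall>x\<in>W. \<forall>y\<in>W. f (x + y) = f x + f y) \<and> (\<forall>c. \<forall>x\<in>W. f (c *\<^sub>R x) = c *\<^sub>R f x)"

text \<open>
  A representation of a group \<open>\<Psi>\<close> of permutations (under composition) consists of a carrier
  subspace \<open>W\<close> and an action \<open>\<rho>\<close>, of which only the values on \<open>\<Psi>\<close> and \<open>W\<close> matter.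
\<close>

definition real_rep ::
  "('v \<Rightarrow> 'v) set \<Rightarrow> 'a::real_vector set \<Rightarrow> (('v \<Rightarrow> 'v) \<Rightarrow> 'a \<Rightarrow> 'a) \<Rightarrow> bool"
  where "real_rep \<Psi> W \<rho> \<longleftrightarrow>
    subspace W \<and>
    (\<forall>\<sigma>\<in>\<Psi>. \<rho> \<sigma> ` W \<subseteq> W \<and> linear_on W (\<rho> \<sigma>)) \<and>
    (\<forall>x\<in>W. \<rho> id x = x) \<and>
    (\<forall>\<sigma>\<in>\<Psi>. \<forall>\<tau>\<in>\<Psi>. \<forall>x\<in>W. \<rho> (\<sigma> \<circ> \<tau>) x = \<rho> \<sigma> (\<rho> \<tau> x))"

definition subrep ::
  "('v \<Rightarrow> 'v) set \<Rightarrow> 'a::real_vector set \<Rightarrow> 'a set \<Rightarrow> (('v \<Rightarrow> 'v) \<Rightarrow> 'a \<Rightarrow> 'a) \<Rightarrow> bool"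
  where "subrep \<Psi> W' W \<rho> \<longleftrightarrow> subspace W' \<and> W' \<subseteq> W \<and> (\<forall>\<sigma>\<in>\<Psi>. \<rho> \<sigma> ` W' \<subseteq> W')"

definition irreducible_rep ::
  "('v \<Rightarrow> 'v) set \<Rightarrow> 'a::real_vector set \<Rightarrow> (('v \<Rightarrow> 'v) \<Rightarrow> 'a \<Rightarrow> 'a) \<Rightarrow> bool"
  where "irreducible_rep \<Psi> W \<rho> \<longleftrightarrow>
    real_rep \<Psi> W \<rho> \<and> W \<noteq> {0} \<and> (\<forall>W'. subrep \<Psi> W' W \<rho> \<longrightarrow> W' = {0} \<or> W' = W)"

definition rep_iso ::
  "('v \<Rightarrow> 'v) set \<Rightarrow> 'a::real_vector set \<Rightarrow> (('v \<Rightarrow> 'v) \<Rightarrow> 'a \<Rightarrow> 'a)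
    \<Rightarrow> 'b::real_vector set \<Rightarrow> (('v \<Rightarrow> 'v) \<Rightarrow> 'b \<Rightarrow> 'b) \<Rightarrow> bool"
  where "rep_iso \<Psi> W \<rho> W' \<rho>' \<longleftrightarrow>
    (\<exists>T. linear_on W T \<and> bij_betw T W W' \<and> (\<forall>\<sigma>\<in>\<Psi>. \<forall>x\<in>W. T (\<rho> \<sigma> x) = \<rho>' \<sigma> (T x)))"

text \<open>
  \<open>U \<otimes> \<real>\<^sup>m\<close> with trivial action on the second factor, realised as the \<open>m\<close>-tuples of elements
  of \<open>U\<close> (sequences vanishing from index \<open>m\<close> on) with the coordinatewise action:
  \<open>u \<otimes> e\<^sub>i\<close> is the tuple with \<open>u\<close> in position \<open>i\<close> and \<open>0\<close> elsewhere.
\<close>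

definition tensor_carrier :: "'a::real_vector set \<Rightarrow> nat \<Rightarrow> (nat \<Rightarrow> 'a) set"
  where "tensor_carrier U m = {f. (\<forall>i<m. f i \<in> U) \<and> (\<forall>i\<ge>m. f i = 0)}"

definition tensor_action ::
  "(('v \<Rightarrow> 'v) \<Rightarrow> 'a \<Rightarrow> 'a::real_vector) \<Rightarrow> nat \<Rightarrow> ('v \<Rightarrow> 'v) \<Rightarrow> (nat \<Rightarrow> 'a) \<Rightarrow> nat \<Rightarrow> 'a"
  where "tensor_action \<rho> m \<sigma> f = (\<lambda>i. if i < m then \<rho> \<sigma> (f i) else 0)"

definition isotypic_decomposition ::
  "('v \<Rightarrow> 'v) set \<Rightarrow> 'a::real_vector set \<Rightarrow> (('v \<Rightarrow> 'v) \<Rightarrow> 'a \<Rightarrow> 'a) \<Rightarrow> nat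
    \<Rightarrow> (nat \<Rightarrow> 'a set) \<Rightarrow> (nat \<Rightarrow> 'u::real_vector set)
    \<Rightarrow> (nat \<Rightarrow> ('v \<Rightarrow> 'v) \<Rightarrow> 'u \<Rightarrow> 'u) \<Rightarrow> (nat \<Rightarrow> nat) \<Rightarrow> bool"
  where "isotypic_decomposition \<Psi> W \<rho> h X U \<rho>U m \<longleftrightarrow>
    (\<forall>j\<in>{1..h}. subrep \<Psi> (X j) W \<rho>) \<and>
    (\<forall>w\<in>W. \<exists>!x. x \<in> Pi\<^sub>E {1..h} X \<and> w = (\<Sum>j\<in>{1..h}. x j)) \<and>
    (\<forall>j\<in>{1..h}. irreducible_rep \<Psi> (U j) (\<rho>U j) \<and> m j \<ge> 1 \<and>
       rep_iso \<Psi> (X j) \<rho> (tensor_carrier (U j) (m j)) (tensor_action (\<rho>U j) (m j))) \<and>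
    (\<forall>i\<in>{1..h}. \<forall>j\<in>{1..h}. i \<noteq> j \<longrightarrow> \<not> rep_iso \<Psi> (U i) (\<rho>U i) (U j) (\<rho>U j))"

text \<open>\<open>inv_into UNIV \<sigma>\<close> is the inverse function; the notation \<open>inv\<close> belongs to \<open>HOL-Algebra\<close> here.\<close>

definition perm_action :: "('v \<Rightarrow> 'v) \<Rightarrow> real ^ 'v \<Rightarrow> real ^ ('v::finite)"
  where "perm_action \<sigma> \<phi> = (\<chi> u. \<phi> $ inv_into UNIV \<sigma> u)"


section \<open>Edge orbits and cones\<close>

definition edge_orbits :: "('v \<Rightarrow> 'v) set \<Rightarrow> 'v set set \<Rightarrow> 'v set set set"
  where "edge_orbits \<Psi> E = (\<lambda>e. (\<lambda>\<sigma>. \<sigma> ` e) ` \<Psi>) ` E"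

text \<open>
  The coordinates of \<open>\<real>\<^sup>s\<close> are indexed by the orbits themselves instead of by an enumeration of
  them, and \<open>\<real>\<^sup>s\<close> is the coordinate subspace of \<open>real ^ ('v set set)\<close> belonging to the orbits;
  this includes \<open>s = 0\<close> (the one-vertex graph).
\<close>

definition ell :: "('v \<Rightarrow> 'v) set \<Rightarrow> 'v set set \<Rightarrow> real ^ 'v \<Rightarrow> real ^ ('v::finite set set)"
  where "ell \<Psi> E \<phi> = (\<chi> Q. if Q \<in> edge_orbits \<Psi> E then (\<Sum>e\<in>Q. edge_sq \<phi> e) else 0)"

definition Cone :: "'a::real_vector set \<Rightarrow> 'a set"
  where "Cone S = {(\<Sum>a\<in>T. c a *\<^sub>R a) |T c. finite T \<and> T \<subseteq> S \<and> (\<forall>a\<in>T. c a \<ge> 0)}"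

definition polyhedral_cone :: "'a::euclidean_space set \<Rightarrow> bool"
  where "polyhedral_cone C \<longleftrightarrow> polyhedron C \<and> convex_cone C"

end

theory Submission
  imports Defs
begin

text \<open>
  Each coordinate of \<open>ell \<Psi> E\<close> is a quadratic form \<open>\<phi> \<mapsto> \<phi> \<bullet> A \<phi>\<close>, where \<open>A\<close> is the Laplacian
  of the subgraph formed by the edges of one orbit. Since \<open>\<Psi>\<close> permutes the edges of an orbit, the
  form is invariant under the orthogonal action of \<open>\<Psi>\<close>. Schur's lemma then determines it on a
  multiplicity-free sum \<open>X 1 \<oplus> \<dots> \<oplus> X h\<close>: on each irreducible summand it is a real multiple of the
  squared norm (\<open>scalar_on_irreducible\<close>), and the cross terms between two summands vanish because
  the summands are not isomorphic (\<open>vanishes_between_nonisomorphic\<close>).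

  Hence for \<open>w = x 1 + \<dots> + x h\<close> every coordinate of \<open>ell \<Psi> E w\<close> is the same combination of the
  coordinates of the \<open>ell \<Psi> E (\<phi> j)\<close>, with the coefficients \<open>(norm (x j) / norm (\<phi> j))\<^sup>2\<close>
  (\<open>ell_multiplicity_free_sum\<close>). These coefficients do not depend on the orbit and are nonnegative, so
  the image lies in the cone; and they take arbitrary nonnegative values, as scaling \<open>\<phi> j\<close> by
  \<open>sqrt (c j)\<close> shows, so the image is the whole cone. Polyhedrality holds because finitely many
  vectors generate the cone.

  The scalar on an irreducible summand exists although the field is \<open>\<real>\<close>: the form is symmetric, so
  its maximum over the unit sphere of the summand plays the role of an eigenvalue.
\<close>

section \<open>Irreducible representations and their isomorphisms\<close>

lemma linear_on_0: "linear_on W f \<Longrightarrow> subspace W \<Longrightarrow> f 0 = 0"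
  unfolding linear_on_def by (metis scaleR_zero_left subspace_0)

lemma irreducible_repD:
  assumes "irreducible_rep \<Psi> W \<rho>"
  shows "real_rep \<Psi> W \<rho>" "subspace W" "W \<noteq> {0}" "\<And>\<sigma> x. \<sigma> \<in> \<Psi> \<Longrightarrow> x \<in> W \<Longrightarrow> \<rho> \<sigma> x \<in> W"
    "\<And>\<sigma>. \<sigma> \<in> \<Psi> \<Longrightarrow> linear_on W (\<rho> \<sigma>)"
    "\<And>W'. subrep \<Psi> W' W \<rho> \<Longrightarrow> W' = {0} \<or> W' = W"
  using assms by (auto simp: irreducible_rep_def real_rep_def image_subset_iff)

lemma rep_iso_trans:
  assumes "rep_iso \<Psi> W1 \<rho>1 W2 \<rho>2" and "rep_iso \<Psi> W2 \<rho>2 W3 \<rho>3"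
  shows "rep_iso \<Psi> W1 \<rho>1 W3 \<rho>3"
proof -
  obtain S where S: "linear_on W1 S" "bij_betw S W1 W2" "\<forall>\<sigma>\<in>\<Psi>. \<forall>x\<in>W1. S (\<rho>1 \<sigma> x) = \<rho>2 \<sigma> (S x)"
    using assms(1) unfolding rep_iso_def by blast
  obtain T where T: "linear_on W2 T" "bij_betw T W2 W3" "\<forall>\<sigma>\<in>\<Psi>. \<forall>x\<in>W2. T (\<rho>2 \<sigma> x) = \<rho>3 \<sigma> (T x)"
    using assms(2) unfolding rep_iso_def by blast
  have mem: "S x \<in> W2" if "x \<in> W1" for x
    using S(2) that by (auto simp: bij_betw_def)
  have "linear_on W1 (T \<circ> S)"
    using S(1) T(1) mem by (simp add: linear_on_def)
  moreover have "bij_betw (T \<circ> S) W1 W3"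
    using S(2) T(2) by (rule bij_betw_trans)
  ultimately show ?thesis
    unfolding rep_iso_def using S(3) T(3) mem by (intro exI[of _ "T \<circ> S"]) simp
qed

lemma rep_iso_sym:
  assumes "rep_iso \<Psi> W \<rho> W' \<rho>'" and "real_rep \<Psi> W \<rho>"
  shows "rep_iso \<Psi> W' \<rho>' W \<rho>"
proof -
  obtain T where T: "linear_on W T" "bij_betw T W W'" "\<forall>\<sigma>\<in>\<Psi>. \<forall>x\<in>W. T (\<rho> \<sigma> x) = \<rho>' \<sigma> (T x)"
    using assms(1) unfolding rep_iso_def by blast
  have W: "subspace W" "\<And>\<sigma> x. \<sigma> \<in> \<Psi> \<Longrightarrow> x \<in> W \<Longrightarrow> \<rho> \<sigma> x \<in> W"
    using assms(2) by (auto simp: real_rep_def)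
  define S where "S = inv_into W T"
  have S: "S y \<in> W" "T (S y) = y" if "y \<in> W'" for y
    using T(2) that by (auto simp: S_def bij_betw_def inv_into_into f_inv_into_f)
  have ST: "S y = x" if "x \<in> W" "T x = y" for x y
    using T(2) that by (auto simp: S_def bij_betw_def)
  have "linear_on W' S"
    unfolding linear_on_def
  proof (intro conjI ballI allI)
    show "S (x + y) = S x + S y" if "x \<in> W'" "y \<in> W'" for x y
      using that S T(1) W(1) by (intro ST) (auto simp: linear_on_def subspace_add)
    show "S (c *\<^sub>R x) = c *\<^sub>R S x" if "x \<in> W'" for c x
      using that S T(1) W(1) by (intro ST) (auto simp: linear_on_def subspace_scale)
  qed
  moreover have "bij_betw S W' W"
    using T(2) by (simp add: S_def bij_betw_inv_into)
  moreover have "S (\<rho>' \<sigma> x) = \<rho> \<sigma> (S x)" if "\<sigma> \<in> \<Psi>" "x \<in> W'" for \<sigma> x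
    using that S T(3) W(2) by (intro ST) auto
  ultimately show ?thesis
    unfolding rep_iso_def by blast
qed

lemma irreducible_rep_iso:
  assumes "rep_iso \<Psi> W \<rho> W' \<rho>'" and "real_rep \<Psi> W \<rho>" and "irreducible_rep \<Psi> W' \<rho>'"
  shows "irreducible_rep \<Psi> W \<rho>"
proof -
  obtain T where T: "linear_on W T" "bij_betw T W W'" "\<forall>\<sigma>\<in>\<Psi>. \<forall>x\<in>W. T (\<rho> \<sigma> x) = \<rho>' \<sigma> (T x)"
    using assms(1) unfolding rep_iso_def by blast
  note W' = irreducible_repD(2,3)[OF assms(3)]
  have W: "subspace W" using assms(2) by (simp add: real_rep_def)
  have T0: "T 0 = 0" using linear_on_0 T(1) W by blast
  have img: "T ` W = W'" and inj: "inj_on T W" using T(2) by (auto simp: bij_betw_def)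
  have ne: "W \<noteq> {0}" using img T0 W'(2) by auto
  have "Z = {0} \<or> Z = W" if Z: "subrep \<Psi> Z W \<rho>" for Z
  proof -
    have Z': "subspace Z" "Z \<subseteq> W" "\<And>\<sigma> x. \<sigma> \<in> \<Psi> \<Longrightarrow> x \<in> Z \<Longrightarrow> \<rho> \<sigma> x \<in> Z"
      using Z by (auto simp: subrep_def)
    have "subspace (T ` Z)"
      unfolding subspace_def
    proof (intro conjI ballI allI)
      show "0 \<in> T ` Z" using T0 Z'(1) by (metis image_eqI subspace_0)
      show "x + y \<in> T ` Z" if "x \<in> T ` Z" "y \<in> T ` Z" for x y
        using that T(1) Z'(1,2) unfolding linear_on_def
        by (smt (verit, best) image_iff subsetD subspace_add)
      show "c *\<^sub>R x \<in> T ` Z" if "x \<in> T ` Z" for c x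
        using that T(1) Z'(1,2) unfolding linear_on_def
        by (smt (verit, best) image_iff subsetD subspace_scale)
    qed
    moreover have "\<rho>' \<sigma> ` T ` Z \<subseteq> T ` Z" if "\<sigma> \<in> \<Psi>" for \<sigma>
      using T(3) Z'(2,3) that by (smt (verit, best) image_iff subsetD subsetI)
    ultimately have "subrep \<Psi> (T ` Z) W' \<rho>'"
      using img Z'(2) by (auto simp: subrep_def)
    then consider "T ` Z = {0}" | "T ` Z = W'"
      using assms(3) by (auto simp: irreducible_rep_def)
    then show ?thesis
    proof cases
      case 1
      then have "T ` Z = T ` {0}" using T0 by simp
      then have "Z = {0}"
        using inj Z'(2) W inj_on_image_eq_iff subspace_0 by (metis empty_subsetI insert_subset)
      then show ?thesis ..
    next
      case 2
      then show ?thesis using inj Z'(2) img by (metis inj_on_image_eq_iff order_refl)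
    qed
  qed
  then show ?thesis
    using assms(2) ne by (simp add: irreducible_rep_def)
qed

text \<open>
  With multiplicity one the tensor factor \<open>\<real>\<^sup>m\<close> is a line, so that an isotypic component is a copy of
  its irreducible representation \<open>U\<close>.
\<close>

lemma rep_iso_tensor_1:
  assumes "real_rep \<Psi> U \<rho>"
  shows "rep_iso \<Psi> (tensor_carrier U 1) (tensor_action \<rho> 1) U \<rho>"
  unfolding rep_iso_def
proof (intro exI conjI ballI)
  show "linear_on (tensor_carrier U 1) (\<lambda>f. f 0)"
    by (simp add: linear_on_def scaleR_fun_def)
  show "bij_betw (\<lambda>f. f 0) (tensor_carrier U 1) U"
    by (rule bij_betw_byWitness[where f' = "\<lambda>u i. if i = 0 then u else 0"])
      (auto simp: tensor_carrier_def fun_eq_iff)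
qed (simp add: tensor_action_def)

text \<open>
  Schur's lemma: the kernel of an equivariant map is a subrepresentation of \<open>X\<close> and its image one of
  \<open>Y\<close>, so by irreducibility a nonzero map would be an isomorphism.
\<close>

lemma schur_zero:
  assumes X: "irreducible_rep \<Psi> X \<rho>" and Y: "irreducible_rep \<Psi> Y \<rho>'"
    and niso: "\<not> rep_iso \<Psi> X \<rho> Y \<rho>'"
    and lin: "linear_on X T" and maps: "T ` X \<subseteq> Y"
    and equiv: "\<And>\<sigma> x. \<sigma> \<in> \<Psi> \<Longrightarrow> x \<in> X \<Longrightarrow> T (\<rho> \<sigma> x) = \<rho>' \<sigma> (T x)"
    and x: "x \<in> X"
  shows "T x = 0"
proof (rule ccontr)
  assume nz: "T x \<noteq> 0"
  note sX = irreducible_repD(2,4)[OF X] and sY = irreducible_repD(2,5)[OF Y]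
  have add: "T (a + b) = T a + T b" if "a \<in> X" "b \<in> X" for a b
    using lin that by (simp add: linear_on_def)
  have scale: "T (c *\<^sub>R a) = c *\<^sub>R T a" if "a \<in> X" for a c
    using lin that by (simp add: linear_on_def)
  have T0: "T 0 = 0" using linear_on_0 lin sX(1) by blast
  have "subrep \<Psi> {a \<in> X. T a = 0} X \<rho>"
    unfolding subrep_def subspace_def
    using sX sY T0 add scale equiv linear_on_0[OF sY(2) sY(1)]
    by (auto simp: subspace_0 subspace_add subspace_scale)
  then have "{a \<in> X. T a = 0} = {0} \<or> {a \<in> X. T a = 0} = X"
    using X by (simp add: irreducible_rep_def)
  then have ker: "\<And>a. a \<in> X \<Longrightarrow> T a = 0 \<Longrightarrow> a = 0"
    using nz x by blast
  have inj: "inj_on T X"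
  proof (rule inj_onI)
    fix a b assume ab: "a \<in> X" "b \<in> X" "T a = T b"
    have "T (a + (-1) *\<^sub>R b) = T a + T ((-1) *\<^sub>R b)"
      using ab subspace_scale[OF sX(1)] by (intro add)
    also have "\<dots> = 0" using ab(3) scale[OF ab(2), of "-1"] by simp
    finally have "T (a + (-1) *\<^sub>R b) = 0" .
    then show "a = b"
      using ker[of "a + (-1) *\<^sub>R b"] ab sX(1) by (simp add: subspace_diff)
  qed
  have "subrep \<Psi> (T ` X) Y \<rho>'"
    unfolding subrep_def subspace_def
  proof (intro conjI ballI allI)
    show "0 \<in> T ` X" using T0 sX(1) by (metis image_eqI subspace_0)
    show "a + b \<in> T ` X" if "a \<in> T ` X" "b \<in> T ` X" for a b
      using that add sX(1) by (smt (verit, best) image_iff subspace_add)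
    show "c *\<^sub>R a \<in> T ` X" if "a \<in> T ` X" for a c
      using that scale sX(1) by (smt (verit, best) image_iff subspace_scale)
    show "\<rho>' \<sigma> ` T ` X \<subseteq> T ` X" if "\<sigma> \<in> \<Psi>" for \<sigma>
      using that equiv sX(2) by (smt (verit, best) image_iff subsetI)
  qed (use maps in auto)
  then have "T ` X = Y"
    using Y nz x by (auto simp: irreducible_rep_def)
  then have "rep_iso \<Psi> X \<rho> Y \<rho>'"
    unfolding rep_iso_def bij_betw_def using lin inj equiv by blast
  with niso show False ..
qed


section \<open>Invariant quadratic forms\<close>

text \<open>
  The right inverse of an orthogonal transformation is its adjoint; that it again comes from \<open>\<Psi>\<close> is
  what makes radicals of invariant forms into subrepresentations.
\<close>

locale orthogonal_action =
  fixes \<Psi> :: "('v \<Rightarrow> 'v) set"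
    and \<rho> :: "('v \<Rightarrow> 'v) \<Rightarrow> 'a::euclidean_space \<Rightarrow> 'a"
  assumes orthogonal: "\<sigma> \<in> \<Psi> \<Longrightarrow> orthogonal_transformation (\<rho> \<sigma>)"
    and right_inverse: "\<sigma> \<in> \<Psi> \<Longrightarrow> \<exists>\<tau>\<in>\<Psi>. \<forall>x. \<rho> \<sigma> (\<rho> \<tau> x) = x"

text \<open>
  An invariant quadratic form is represented by its symmetric operator \<open>A\<close>, so that its polar form
  is \<open>x \<bullet> A y\<close>.
\<close>

locale invariant_form = orthogonal_action \<Psi> \<rho>
  for \<Psi> :: "('v \<Rightarrow> 'v) set" and \<rho> :: "('v \<Rightarrow> 'v) \<Rightarrow> 'a::euclidean_space \<Rightarrow> 'a" +
  fixes A :: "'a \<Rightarrow> 'a"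
  assumes linear_A: "linear A"
    and symmetric_A: "x \<bullet> A y = y \<bullet> A x"
    and invariant_A: "\<sigma> \<in> \<Psi> \<Longrightarrow> \<rho> \<sigma> x \<bullet> A (\<rho> \<sigma> x) = x \<bullet> A x"
begin

lemma polar_invariant:
  assumes "\<sigma> \<in> \<Psi>"
  shows "\<rho> \<sigma> x \<bullet> A (\<rho> \<sigma> y) = x \<bullet> A y"
proof -
  have lin: "linear (\<rho> \<sigma>)"
    using orthogonal[OF assms] by (simp add: orthogonal_transformation_def)
  show ?thesis
    using invariant_A[OF assms, of "x + y"] invariant_A[OF assms, of x] invariant_A[OF assms, of y]
      symmetric_A[of "\<rho> \<sigma> x" "\<rho> \<sigma> y"] symmetric_A[of x y]
    by (simp add: linear_add[OF lin] linear_add[OF linear_A] inner_add_left inner_add_right)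
qed

text \<open>
  Equivariance of \<open>A\<close> in the form in which it is used: a group element may be moved to the other
  argument, both in the polar form and in the inner product, at the price of replacing it by its inverse.
\<close>

lemma polar_move:
  assumes "\<sigma> \<in> \<Psi>"
  obtains \<tau> where "\<tau> \<in> \<Psi>" "\<And>x y. y \<bullet> A (\<rho> \<sigma> x) = \<rho> \<tau> y \<bullet> A x"
    "\<And>x y. y \<bullet> \<rho> \<sigma> x = \<rho> \<tau> y \<bullet> x"
proof -
  obtain \<tau> where \<tau>: "\<tau> \<in> \<Psi>" "\<forall>x. \<rho> \<sigma> (\<rho> \<tau> x) = x"
    using right_inverse[OF assms] by blast
  show thesis
    using that[OF \<tau>(1)] \<tau>(2) polar_invariant[OF assms] orthogonal[OF assms]
    by (metis orthogonal_transformation_def)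
qed

text \<open>
  Let \<open>c\<close> be the maximum of the form on the unit sphere of \<open>X\<close>. The form \<open>c * (x \<bullet> x) - x \<bullet> A x\<close> is
  then positive semidefinite on \<open>X\<close>, and it vanishes at a maximiser, which therefore belongs to its
  radical. The radical is a nonzero subrepresentation, hence all of \<open>X\<close>.
\<close>

lemma scalar_on_irreducible:
  assumes X: "irreducible_rep \<Psi> X \<rho>"
  obtains c where "\<And>x. x \<in> X \<Longrightarrow> x \<bullet> A x = c * (x \<bullet> x)"
proof -
  note sX = irreducible_repD(2)[OF X] and ne = irreducible_repD(3)[OF X]
    and inv = irreducible_repD(4)[OF X]
  have A: "A (x + y) = A x + A y" "A (r *\<^sub>R x) = r *\<^sub>R A x" for x y r
    using linear_A by (simp_all add: linear_add linear_scale)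
  obtain a where a: "a \<in> X" "a \<noteq> 0" using ne sX subspace_0 by blast
  have "compact (X \<inter> sphere 0 1)"
    using sX by (intro closed_Int_compact closed_subspace compact_sphere)
  moreover have "a /\<^sub>R norm a \<in> X \<inter> sphere 0 1"
    using a sX by (simp add: subspace_scale)
  moreover have "continuous_on (X \<inter> sphere 0 1) (\<lambda>x. x \<bullet> A x)"
    using linear_A by (intro continuous_intros linear_continuous_on) (simp add: linear_conv_bounded_linear)
  ultimately obtain x0 where x0: "x0 \<in> X" "norm x0 = 1"
    and max: "\<And>x. x \<in> X \<Longrightarrow> norm x = 1 \<Longrightarrow> x \<bullet> A x \<le> x0 \<bullet> A x0"
    using continuous_attains_sup[of "X \<inter> sphere 0 1" "\<lambda>x. x \<bullet> A x"] by force
  define c where "c = x0 \<bullet> A x0"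
  define b where "b x y = c * (x \<bullet> y) - x \<bullet> A y" for x y
  have b_add: "b (x + y) z = b x z + b y z" "b z (x + y) = b z x + b z y" for x y z
    by (simp_all add: b_def A inner_add_left inner_add_right algebra_simps)
  have b_scale: "b (r *\<^sub>R x) z = r * b x z" "b z (r *\<^sub>R x) = r * b z x" for x z r
    by (simp_all add: b_def A algebra_simps)
  have b_sym: "b x y = b y x" for x y
    by (simp add: b_def inner_commute[of x y] symmetric_A[of x y])
  have b_nonneg: "b x x \<ge> 0" if x: "x \<in> X" for x
  proof (cases "x = 0")
    case True
    then show ?thesis using b_scale(1)[of 0 0 0] by simp
  next
    case False
    have "b (x /\<^sub>R norm x) (x /\<^sub>R norm x) \<ge> 0"
      using max[of "x /\<^sub>R norm x"] x False sX
      by (simp add: b_def c_def subspace_scale norm_eq_1[symmetric] flip: power2_norm_eq_inner)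
    then show ?thesis
      using False by (simp add: b_scale zero_le_mult_iff)
  qed
  have b_x0: "b x0 x0 = 0"
    using x0(2) by (simp add: b_def c_def norm_eq_1)
  have rad_x0: "b y x0 = 0" if y: "y \<in> X" for y
  proof (rule ccontr)
    assume nz: "b y x0 \<noteq> 0"
    \<comment> \<open>Moving from \<open>x0\<close> in the direction \<open>y\<close> changes the form by \<open>2 t (b y x0) + t\<^sup>2 (b y y)\<close>. The
      minimising \<open>t\<close> would have denominator \<open>b y y\<close>, which may be zero; adding \<open>1\<close> keeps the
      value negative.\<close>
    define t where "t = - b y x0 / (b y y + 1)"
    have pos: "b y y + 1 > 0" using b_nonneg[OF y] by simp
    have "0 \<le> b (x0 + t *\<^sub>R y) (x0 + t *\<^sub>R y)"
      using x0(1) y sX by (intro b_nonneg) (simp add: subspace_add subspace_scale)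
    also have "\<dots> = 2 * t * b y x0 + t\<^sup>2 * b y y"
      by (simp add: b_add b_scale b_x0 b_sym[of x0 y] power2_eq_square algebra_simps)
    also have "\<dots> = - (b y x0)\<^sup>2 * (b y y + 2) / (b y y + 1)\<^sup>2"
    proof -
      have "b y x0 = - t * (b y y + 1)" using pos by (simp add: t_def)
      then have "2 * t * b y x0 + t\<^sup>2 * b y y = - t\<^sup>2 * (b y y + 2)"
        and "- (b y x0)\<^sup>2 * (b y y + 2) / (b y y + 1)\<^sup>2 = - t\<^sup>2 * (b y y + 2)"
        using pos by (simp_all add: power_mult_distrib) (simp add: power2_eq_square algebra_simps)
      then show ?thesis by simp
    qed
    also have "\<dots> < 0"
      using nz pos b_nonneg[OF y] by (auto intro!: divide_neg_pos mult_neg_pos)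
    finally show False by simp
  qed
  define R where "R = {x \<in> X. \<forall>y\<in>X. b y x = 0}"
  have "subrep \<Psi> R X \<rho>"
    unfolding subrep_def
  proof (intro conjI ballI)
    show "subspace R"
      unfolding subspace_def R_def
      using sX b_add b_scale b_scale(2)[of _ 0 0]
      by (auto simp: subspace_0 subspace_add subspace_scale)
    show "\<rho> \<sigma> ` R \<subseteq> R" if \<sigma>: "\<sigma> \<in> \<Psi>" for \<sigma>
    proof -
      obtain \<tau> where \<tau>: "\<tau> \<in> \<Psi>" "\<And>x y. y \<bullet> A (\<rho> \<sigma> x) = \<rho> \<tau> y \<bullet> A x"
        "\<And>x y. y \<bullet> \<rho> \<sigma> x = \<rho> \<tau> y \<bullet> x"
        using polar_move[OF \<sigma>] by metis
      then have "b y (\<rho> \<sigma> x) = b (\<rho> \<tau> y) x" for x y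
        by (simp add: b_def)
      then show ?thesis
        using inv \<sigma> \<tau>(1) by (auto simp: R_def)
    qed
  qed (auto simp: R_def)
  moreover have "x0 \<in> R" "x0 \<noteq> 0"
    using x0 rad_x0 by (auto simp: R_def)
  ultimately have "R = X"
    using X by (auto simp: irreducible_rep_def)
  have "x \<bullet> A x = c * (x \<bullet> x)" if "x \<in> X" for x
  proof -
    have "b x x = 0" using that \<open>R = X\<close> unfolding R_def by blast
    then show ?thesis by (simp add: b_def)
  qed
  then show thesis by (rule that)
qed

text \<open>
  By the Riesz representation on \<open>Y\<close>, the polar form on \<open>X \<times> Y\<close> is \<open>y \<bullet> T x\<close> for a unique map \<open>T\<close>
  from \<open>X\<close> to \<open>Y\<close>, namely the orthogonal projection onto \<open>Y\<close> after \<open>A\<close>. Uniqueness makes \<open>T\<close> linear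
  and equivariant, and Schur's lemma makes it zero.
\<close>

lemma vanishes_between_nonisomorphic:
  assumes X: "irreducible_rep \<Psi> X \<rho>" and Y: "irreducible_rep \<Psi> Y \<rho>"
    and niso: "\<not> rep_iso \<Psi> X \<rho> Y \<rho>"
    and x: "x \<in> X" and y: "y \<in> Y"
  shows "y \<bullet> A x = 0"
proof -
  note sX = irreducible_repD(2,4)[OF X] and sY = irreducible_repD(2,4)[OF Y]
  have "\<exists>z\<in>Y. \<forall>y\<in>Y. y \<bullet> A x = y \<bullet> z" for x
  proof -
    obtain z w where z: "z \<in> span Y" "\<And>y. y \<in> span Y \<Longrightarrow> orthogonal w y" "A x = z + w"
      using orthogonal_subspace_decomp_exists[of Y "A x"] by metis
    have "y \<bullet> A x = y \<bullet> z" if "y \<in> Y" for y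
      using z(2)[OF span_base[OF that]] z(3)
      by (simp add: orthogonal_def inner_add_right inner_commute)
    moreover have "z \<in> Y" using z(1) sY(1) by (simp add: span_eq_iff[THEN iffD2])
    ultimately show ?thesis by blast
  qed
  then obtain T where T: "\<And>x. T x \<in> Y" "\<And>x y. y \<in> Y \<Longrightarrow> y \<bullet> A x = y \<bullet> T x"
    by metis
  have T_unique: "T x = z" if z: "z \<in> Y" and eq: "\<And>y. y \<in> Y \<Longrightarrow> y \<bullet> A x = y \<bullet> z" for x z
  proof -
    have "T x - z \<in> Y" using T(1) z sY(1) by (simp add: subspace_diff)
    then have "(T x - z) \<bullet> (T x - z) = 0"
      using T(2)[of "T x - z" x] eq[of "T x - z"] by (simp add: inner_diff_right)
    then show ?thesis by simp
  qed
  have "linear_on X T"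
    unfolding linear_on_def
    using T sY(1) linear_A
    by (auto intro!: T_unique simp: subspace_add subspace_scale linear_add linear_scale inner_add_right)
  moreover have "T (\<rho> \<sigma> x) = \<rho> \<sigma> (T x)" if \<sigma>: "\<sigma> \<in> \<Psi>" for \<sigma> x
  proof (rule T_unique)
    obtain \<tau> where \<tau>: "\<tau> \<in> \<Psi>" "\<And>x y. y \<bullet> A (\<rho> \<sigma> x) = \<rho> \<tau> y \<bullet> A x"
      "\<And>x y. y \<bullet> \<rho> \<sigma> x = \<rho> \<tau> y \<bullet> x"
      using polar_move[OF \<sigma>] by metis
    show "y \<bullet> A (\<rho> \<sigma> x) = y \<bullet> \<rho> \<sigma> (T x)" if "y \<in> Y" for y
      using \<tau> that sY(2) T(2) by metis
  qed (use T sY(2) \<sigma> in blast)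
  ultimately have "T x = 0"
    using schur_zero[OF X Y niso, of T] T(1) x by blast
  then show ?thesis using T(2) y by simp
qed

text \<open>
  The coefficients on the right do not involve \<open>A\<close>. This is what lets all orbit forms be evaluated
  simultaneously.
\<close>

lemma form_on_multiplicity_free_sum:
  fixes X :: "'i \<Rightarrow> 'a set"
  assumes fin: "finite J"
    and irr: "\<And>j. j \<in> J \<Longrightarrow> irreducible_rep \<Psi> (X j) \<rho>"
    and niso: "\<And>i j. i \<in> J \<Longrightarrow> j \<in> J \<Longrightarrow> i \<noteq> j \<Longrightarrow> \<not> rep_iso \<Psi> (X i) \<rho> (X j) \<rho>"
    and \<phi>: "\<And>j. j \<in> J \<Longrightarrow> \<phi> j \<in> X j \<and> \<phi> j \<noteq> 0"
    and x: "\<And>j. j \<in> J \<Longrightarrow> x j \<in> X j"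
  shows "(\<Sum>j\<in>J. x j) \<bullet> A (\<Sum>j\<in>J. x j) = (\<Sum>j\<in>J. (norm (x j) / norm (\<phi> j))\<^sup>2 * (\<phi> j \<bullet> A (\<phi> j)))"
proof -
  have "(\<Sum>j\<in>J. x j) \<bullet> A (\<Sum>j\<in>J. x j) = (\<Sum>i\<in>J. \<Sum>j\<in>J. x i \<bullet> A (x j))"
    unfolding linear_sum[OF linear_A] inner_sum_left inner_sum_right by (rule sum.swap)
  also have "\<dots> = (\<Sum>i\<in>J. x i \<bullet> A (x i))"
  proof (rule sum.cong[OF refl])
    fix i assume i: "i \<in> J"
    have "x i \<bullet> A (x j) = (if j = i then x i \<bullet> A (x i) else 0)" if "j \<in> J" for j
      using vanishes_between_nonisomorphic[OF irr irr niso, of j i] i that x by auto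
    then have "(\<Sum>j\<in>J. x i \<bullet> A (x j)) = (\<Sum>j\<in>J. if j = i then x i \<bullet> A (x i) else 0)"
      by (rule sum.cong[OF refl])
    then show "(\<Sum>j\<in>J. x i \<bullet> A (x j)) = x i \<bullet> A (x i)"
      using fin i by simp
  qed
  also have "\<dots> = (\<Sum>j\<in>J. (norm (x j) / norm (\<phi> j))\<^sup>2 * (\<phi> j \<bullet> A (\<phi> j)))"
  proof (rule sum.cong[OF refl])
    fix j assume j: "j \<in> J"
    obtain c where "\<And>z. z \<in> X j \<Longrightarrow> z \<bullet> A z = c * (z \<bullet> z)"
      using scalar_on_irreducible[OF irr[OF j]] by metis
    then show "x j \<bullet> A (x j) = (norm (x j) / norm (\<phi> j))\<^sup>2 * (\<phi> j \<bullet> A (\<phi> j))"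
      using x[OF j] \<phi>[OF j] by (simp add: power_divide flip: power2_norm_eq_inner)
  qed
  finally show ?thesis .
qed

end


section \<open>Permutations acting on vertex functions\<close>

lemma group_aut_group: "group (aut_group E)"
proof (rule groupI)
  fix \<sigma> assume "\<sigma> \<in> carrier (aut_group E)"
  then have \<sigma>: "bij \<sigma>" "\<And>u v. {\<sigma> u, \<sigma> v} \<in> E \<longleftrightarrow> {u, v} \<in> E"
    by (auto simp: aut_group_def)
  have "inv_into UNIV \<sigma> \<in> carrier (aut_group E)"
    using \<sigma> by (simp add: aut_group_def bij_imp_bij_inv) (metis bij_inv_eq_iff)
  then show "\<exists>\<tau>\<in>carrier (aut_group E). \<tau> \<otimes>\<^bsub>aut_group E\<^esub> \<sigma> = \<one>\<^bsub>aut_group E\<^esub>"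
    using \<sigma>(1) by (intro bexI[of _ "inv_into UNIV \<sigma>"]) (simp_all add: aut_group_def bij_is_inj)
qed (auto simp: aut_group_def bij_comp intro: bij_comp)

lemma subgroup_aut_group_inverse:
  assumes "subgroup \<Psi> (aut_group E)" and "\<sigma> \<in> \<Psi>"
  obtains \<tau> where "\<tau> \<in> \<Psi>" "\<sigma> \<circ> \<tau> = id"
proof
  show "inv\<^bsub>aut_group E\<^esub> \<sigma> \<in> \<Psi>"
    using assms by (rule subgroup.m_inv_closed)
  show "\<sigma> \<circ> inv\<^bsub>aut_group E\<^esub> \<sigma> = id"
    using group.r_inv[OF group_aut_group subgroup.mem_carrier[OF assms]]
    by (simp add: aut_group_def[of E, THEN arg_cong[where f = mult]]
        aut_group_def[of E, THEN arg_cong[where f = one]])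
qed

lemma perm_action_apply: "bij \<sigma> \<Longrightarrow> perm_action \<sigma> \<phi> $ \<sigma> u = \<phi> $ u"
  by (simp add: perm_action_def bij_is_inj)

lemma perm_action_id: "perm_action id \<phi> = \<phi>"
  by (simp add: perm_action_def vec_eq_iff)

lemma perm_action_comp:
  assumes "bij \<sigma>" "bij \<tau>"
  shows "perm_action (\<sigma> \<circ> \<tau>) \<phi> = perm_action \<sigma> (perm_action \<tau> \<phi>)"
  using assms by (simp add: perm_action_def o_inv_distrib)

lemma orthogonal_perm_action:
  assumes "bij \<sigma>"
  shows "orthogonal_transformation (perm_action \<sigma>)"
  unfolding orthogonal_transformation_def
proof (intro conjI allI)
  show "linear (perm_action \<sigma>)"
    by (rule linearI) (simp_all add: perm_action_def vec_eq_iff)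
  show "perm_action \<sigma> \<phi> \<bullet> perm_action \<sigma> \<psi> = \<phi> \<bullet> \<psi>" for \<phi> \<psi>
    unfolding inner_vec_def perm_action_def
    using sum.reindex_bij_betw[OF bij_imp_bij_inv[OF assms], of "\<lambda>u. \<phi> $ u \<bullet> \<psi> $ u"] by simp
qed

lemma orthogonal_action_perm:
  assumes "subgroup \<Psi> (aut_group E)"
  shows "orthogonal_action \<Psi> (perm_action :: _ \<Rightarrow> real ^ 'v \<Rightarrow> real ^ 'v::finite)"
proof
  have bij: "bij \<sigma>" if "\<sigma> \<in> \<Psi>" for \<sigma>
    using subgroup.mem_carrier[OF assms that] by (simp add: aut_group_def)
  show "orthogonal_transformation (perm_action \<sigma>)" if "\<sigma> \<in> \<Psi>" for \<sigma> :: "'v \<Rightarrow> 'v"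
    using bij[OF that] by (rule orthogonal_perm_action)
  show "\<exists>\<tau>\<in>\<Psi>. \<forall>x :: real ^ 'v. perm_action \<sigma> (perm_action \<tau> x) = x" if "\<sigma> \<in> \<Psi>" for \<sigma>
    using subgroup_aut_group_inverse[OF assms that] bij that
    by (metis perm_action_comp perm_action_id)
qed

lemma real_rep_perm_action:
  assumes "subgroup \<Psi> (aut_group E)" and "subrep \<Psi> W V perm_action"
  shows "real_rep \<Psi> W perm_action"
proof -
  have bij: "bij \<sigma>" if "\<sigma> \<in> \<Psi>" for \<sigma>
    using subgroup.mem_carrier[OF assms(1) that] by (simp add: aut_group_def)
  then have "linear_on W (perm_action \<sigma>)" if "\<sigma> \<in> \<Psi>" for \<sigma>
    using orthogonal_perm_action[OF bij[OF that]]
    by (simp add: linear_on_def orthogonal_transformation_def linear_add linear_scale)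
  then show ?thesis
    using assms(2) bij by (auto simp: real_rep_def subrep_def perm_action_id perm_action_comp)
qed

text \<open>
  Irreducibility and pairwise non-isomorphism are given for the model representations \<open>U j\<close>, on
  another carrier type; here they are carried over to the components \<open>X j\<close> themselves.
\<close>

lemma multiplicity_one_components:
  assumes grp: "subgroup \<Psi> (aut_group E)"
    and dec: "isotypic_decomposition \<Psi> W perm_action h X U \<rho> m"
    and m: "\<And>j. j \<in> {1..h} \<Longrightarrow> m j = 1"
  shows "\<And>j. j \<in> {1..h} \<Longrightarrow> irreducible_rep \<Psi> (X j) perm_action"
    and "\<And>i j. i \<in> {1..h} \<Longrightarrow> j \<in> {1..h} \<Longrightarrow> i \<noteq> j \<Longrightarrow>
      \<not> rep_iso \<Psi> (X i) perm_action (X j) perm_action"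
proof -
  have rep: "real_rep \<Psi> (X j) perm_action" if "j \<in> {1..h}" for j
    using dec that by (intro real_rep_perm_action[OF grp, of _ W]) (simp add: isotypic_decomposition_def)
  have U: "irreducible_rep \<Psi> (U j) (\<rho> j)" if "j \<in> {1..h}" for j
    using dec that by (simp add: isotypic_decomposition_def)
  have iso: "rep_iso \<Psi> (X j) perm_action (U j) (\<rho> j)" if j: "j \<in> {1..h}" for j
  proof (rule rep_iso_trans)
    show "rep_iso \<Psi> (X j) perm_action (tensor_carrier (U j) 1) (tensor_action (\<rho> j) 1)"
      using dec j m[OF j] unfolding isotypic_decomposition_def by metis
    show "rep_iso \<Psi> (tensor_carrier (U j) 1) (tensor_action (\<rho> j) 1) (U j) (\<rho> j)"
      using U[OF j] by (intro rep_iso_tensor_1) (simp add: irreducible_rep_def)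
  qed
  show "irreducible_rep \<Psi> (X j) perm_action" if "j \<in> {1..h}" for j
    using irreducible_rep_iso[OF iso[OF that] rep[OF that] U[OF that]] .
  show "\<not> rep_iso \<Psi> (X i) perm_action (X j) perm_action"
    if ij: "i \<in> {1..h}" "j \<in> {1..h}" "i \<noteq> j" for i j
  proof
    assume "rep_iso \<Psi> (X i) perm_action (X j) perm_action"
    then have "rep_iso \<Psi> (U i) (\<rho> i) (U j) (\<rho> j)"
      using rep_iso_trans[OF rep_iso_sym[OF iso rep] rep_iso_trans[OF _ iso]] ij by blast
    then show False
      using dec ij by (simp add: isotypic_decomposition_def)
  qed
qed


section \<open>Edge orbits\<close>

lemma edge_orbit_subset:
  assumes "simple_graph E" and "subgroup \<Psi> (aut_group E)" and "Q \<in> edge_orbits \<Psi> E"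
  shows "Q \<subseteq> E"
proof
  fix e assume "e \<in> Q"
  then obtain \<sigma> d where d: "\<sigma> \<in> \<Psi>" "d \<in> E" "e = \<sigma> ` d"
    using assms(3) by (auto simp: edge_orbits_def)
  obtain u v where "d = {u, v}"
    using assms(1) d(2) by (auto simp: simple_graph_def card_2_iff)
  then show "e \<in> E"
    using d subgroup.mem_carrier[OF assms(2) d(1)] by (simp add: aut_group_def)
qed

lemma edge_orbit_bij_betw:
  fixes \<Psi> :: "('v::finite \<Rightarrow> 'v) set"
  assumes "subgroup \<Psi> (aut_group E)" and "Q \<in> edge_orbits \<Psi> E" and "\<sigma> \<in> \<Psi>"
  shows "bij_betw ((`) \<sigma>) Q Q"
proof -
  obtain d where Q: "Q = (\<lambda>\<tau>. \<tau> ` d) ` \<Psi>"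
    using assms(2) by (auto simp: edge_orbits_def)
  have "\<sigma> \<circ> \<tau> \<in> \<Psi>" if "\<tau> \<in> \<Psi>" for \<tau>
    using subgroup.m_closed[OF assms(1,3) that] by (simp add: aut_group_def)
  then have "\<sigma> ` \<tau> ` d \<in> Q" if "\<tau> \<in> \<Psi>" for \<tau>
    unfolding Q image_comp using that by (intro imageI)
  then have "(`) \<sigma> ` Q \<subseteq> Q"
    unfolding Q by blast
  moreover have inj: "inj_on ((`) \<sigma>) Q"
    using subgroup.mem_carrier[OF assms(1,3)]
    by (auto simp: aut_group_def bij_is_inj inj_image_eq_iff intro!: inj_onI)
  ultimately show ?thesis
    by (simp add: bij_betw_def endo_inj_surj)
qed

text \<open>
  The edges of an orbit form a simple graph, whose Laplacian is the operator of the corresponding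
  coordinate of \<open>ell\<close>; the form is invariant because \<open>\<Psi>\<close> permutes its summands.
\<close>

lemma edge_orbit_form:
  fixes E :: "('v::finite) set set"
  assumes E: "simple_graph E" and grp: "subgroup \<Psi> (aut_group E)" and Q: "Q \<in> edge_orbits \<Psi> E"
  shows "invariant_form \<Psi> perm_action ((*v) (laplacian Q))"
    and "ell \<Psi> E \<phi> $ Q = \<phi> \<bullet> (laplacian Q *v \<phi>)"
proof -
  have sQ: "simple_graph Q"
    using edge_orbit_subset[OF assms] E by (auto simp: simple_graph_def)
  then have L: "transpose (laplacian Q) = laplacian Q"
    and form: "\<phi> \<bullet> (laplacian Q *v \<phi>) = (\<Sum>e\<in>Q. edge_sq \<phi> e)" for \<phi>
    using is_laplacian_laplacian[OF sQ] by (auto simp: is_laplacian_def)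
  show "ell \<Psi> E \<phi> $ Q = \<phi> \<bullet> (laplacian Q *v \<phi>)"
    using Q by (simp add: ell_def form)
  show "invariant_form \<Psi> perm_action ((*v) (laplacian Q))"
  proof (intro invariant_form.intro invariant_form_axioms.intro orthogonal_action_perm[OF grp])
    show "linear ((*v) (laplacian Q))" by simp
    show "x \<bullet> (laplacian Q *v y) = y \<bullet> (laplacian Q *v x)" for x y
      using L by (metis dot_lmul_matrix inner_commute transpose_matrix_vector)
    show "perm_action \<sigma> x \<bullet> (laplacian Q *v perm_action \<sigma> x) = x \<bullet> (laplacian Q *v x)"
      if \<sigma>: "\<sigma> \<in> \<Psi>" for \<sigma> x
    proof -
      have bij: "bij \<sigma>"
        using subgroup.mem_carrier[OF grp \<sigma>] by (simp add: aut_group_def)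
      have "(\<Sum>e\<in>Q. edge_sq (perm_action \<sigma> x) e) = (\<Sum>e\<in>Q. edge_sq (perm_action \<sigma> x) (\<sigma> ` e))"
        using sum.reindex_bij_betw[OF edge_orbit_bij_betw[OF grp Q \<sigma>]] by metis
      also have "\<dots> = (\<Sum>e\<in>Q. edge_sq x e)"
      proof (rule sum.cong[OF refl])
        fix e assume "e \<in> Q"
        then obtain u v where "e = {u, v}"
          using sQ by (auto simp: simple_graph_def card_2_iff)
        then show "edge_sq (perm_action \<sigma> x) (\<sigma> ` e) = edge_sq x e"
          using bij by (simp add: edge_sq_doubleton perm_action_apply)
      qed
      finally show ?thesis by (simp add: form)
    qed
  qed
qed

lemma ell_multiplicity_free_sum:
  fixes E :: "('v::finite) set set"
  assumes E: "simple_graph E" and grp: "subgroup \<Psi> (aut_group E)"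
    and J: "finite J"
    and irr: "\<And>j. j \<in> J \<Longrightarrow> irreducible_rep \<Psi> (X j) perm_action"
    and niso: "\<And>i j. i \<in> J \<Longrightarrow> j \<in> J \<Longrightarrow> i \<noteq> j \<Longrightarrow> \<not> rep_iso \<Psi> (X i) perm_action (X j) perm_action"
    and \<phi>: "\<And>j. j \<in> J \<Longrightarrow> \<phi> j \<in> X j \<and> \<phi> j \<noteq> 0"
    and x: "\<And>j. j \<in> J \<Longrightarrow> x j \<in> X j"
  shows "ell \<Psi> E (\<Sum>j\<in>J. x j) = (\<Sum>j\<in>J. (norm (x j) / norm (\<phi> j))\<^sup>2 *\<^sub>R ell \<Psi> E (\<phi> j))"
proof -
  have "ell \<Psi> E (\<Sum>j\<in>J. x j) $ Q = (\<Sum>j\<in>J. (norm (x j) / norm (\<phi> j))\<^sup>2 *\<^sub>R ell \<Psi> E (\<phi> j)) $ Q" for Q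
  proof (cases "Q \<in> edge_orbits \<Psi> E")
    case True
    then show ?thesis
      using invariant_form.form_on_multiplicity_free_sum[OF edge_orbit_form(1)[OF E grp True] J irr niso \<phi> x]
      by (simp add: edge_orbit_form(2)[OF E grp True])
  qed (simp add: ell_def)
  then show ?thesis by (simp add: vec_eq_iff)
qed


section \<open>Cones\<close>

lemma convex_cone_hull_sum:
  assumes "finite I" and "\<And>i. i \<in> I \<Longrightarrow> c i \<ge> 0" and "\<And>i. i \<in> I \<Longrightarrow> f i \<in> S"
  shows "(\<Sum>i\<in>I. c i *\<^sub>R f i) \<in> convex_cone hull S"
proof -
  have "f i \<in> convex_cone hull S" if "i \<in> I" for i
    using assms(3)[OF that] by (rule hull_inc)
  with assms(1,2) show ?thesis
    by (induction I rule: finite_induct)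
      (simp_all add: convex_cone_hull_contains_0 convex_cone_hull_add convex_cone_hull_mul)
qed

lemma Cone_eq_convex_cone_hull: "Cone S = convex_cone hull S"
proof
  show "Cone S \<subseteq> convex_cone hull S"
  proof
    fix x assume "x \<in> Cone S"
    then show "x \<in> convex_cone hull S"
      unfolding Cone_def by (auto intro!: convex_cone_hull_sum)
  qed
  show "convex_cone hull S \<subseteq> Cone S"
  proof (rule hull_minimal)
    show "S \<subseteq> Cone S"
    proof
      fix a assume "a \<in> S"
      then show "a \<in> Cone S"
        unfolding Cone_def by (intro CollectI exI[of _ "{a}"] exI[of _ "\<lambda>_. 1"]) simp
    qed
    show "convex_cone (Cone S)"
      unfolding convex_cone_iff
    proof (intro conjI ballI allI impI)
      show "0 \<in> Cone S"
        unfolding Cone_def by (intro CollectI exI[of _ "{}"]) simp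
      show "r *\<^sub>R x \<in> Cone S" if x: "x \<in> Cone S" and r: "0 \<le> r" for x r
      proof -
        obtain T c where "finite T" "T \<subseteq> S" "\<forall>a\<in>T. c a \<ge> 0" "x = (\<Sum>a\<in>T. c a *\<^sub>R a)"
          using x by (auto simp: Cone_def)
        then show ?thesis
          unfolding Cone_def using r
          by (intro CollectI exI[of _ T] exI[of _ "\<lambda>a. r * c a"]) (simp add: scaleR_right.sum)
      qed
      show "x + y \<in> Cone S" if x: "x \<in> Cone S" and y: "y \<in> Cone S" for x y
      proof -
        obtain T c where T: "finite T" "T \<subseteq> S" "\<forall>a\<in>T. c a \<ge> 0" "x = (\<Sum>a\<in>T. c a *\<^sub>R a)"
          using x by (auto simp: Cone_def)
        obtain T' c' where T': "finite T'" "T' \<subseteq> S" "\<forall>a\<in>T'. c' a \<ge> 0" "y = (\<Sum>a\<in>T'. c' a *\<^sub>R a)"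
          using y by (auto simp: Cone_def)
        define d where "d a = (if a \<in> T then c a else 0)" for a
        define d' where "d' a = (if a \<in> T' then c' a else 0)" for a
        have "x = (\<Sum>a\<in>T \<union> T'. d a *\<^sub>R a)"
          unfolding T(4) using T(1) T'(1) by (intro sum.mono_neutral_cong_left) (auto simp: d_def)
        moreover have "y = (\<Sum>a\<in>T \<union> T'. d' a *\<^sub>R a)"
          unfolding T'(4) using T(1) T'(1) by (intro sum.mono_neutral_cong_left) (auto simp: d'_def)
        ultimately have "x + y = (\<Sum>a\<in>T \<union> T'. (d a + d' a) *\<^sub>R a)"
          by (simp add: scaleR_left_distrib sum.distrib)
        then show ?thesis
          unfolding Cone_def using T T'
          by (intro CollectI exI[of _ "T \<union> T'"] exI[of _ "\<lambda>a. d a + d' a"]) (auto simp: d_def d'_def)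
      qed
    qed
  qed
qed

text \<open>
  The image of the eigenspace is compared with the combinations \<open>?comb c\<close> indexed by \<open>j\<close>, because
  several \<open>j\<close> may give the same generator of the cone.
\<close>

theorem theorem7p3:
  fixes E :: "('v::finite) set set"
    and \<Psi> :: "('v \<Rightarrow> 'v) set"
    and \<mu> :: real
    and h :: nat
    and X :: "nat \<Rightarrow> (real ^ 'v) set"
    and U :: "nat \<Rightarrow> 'u::real_vector set"
    and \<rho> :: "nat \<Rightarrow> ('v \<Rightarrow> 'v) \<Rightarrow> 'u \<Rightarrow> 'u"
    and m :: "nat \<Rightarrow> nat"
    and \<phi> :: "nat \<Rightarrow> real ^ 'v"
  assumes "simple_graph E"
    and "connected_graph E"
    and "subgroup \<Psi> (aut_group E)"
    and "laplacian_eigenvalue E \<mu>"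
    and "isotypic_decomposition \<Psi> (eigenspace E \<mu>) perm_action h X U \<rho> m"
    and "\<And>j. j \<in> {1..h} \<Longrightarrow> m j = 1"
    and "\<And>j. j \<in> {1..h} \<Longrightarrow> \<phi> j \<in> X j \<and> \<phi> j \<noteq> 0"
  shows "polyhedral_cone (ell \<Psi> E ` eigenspace E \<mu>)
    \<and> ell \<Psi> E ` eigenspace E \<mu> = Cone {ell \<Psi> E (\<phi> j) |j. j \<in> {1..h}}"
proof -
  let ?K = "ell \<Psi> E ` eigenspace E \<mu>"
  let ?S = "{ell \<Psi> E (\<phi> j) |j. j \<in> {1..h}}"
  let ?comb = "\<lambda>c. \<Sum>j\<in>{1..h}. c j *\<^sub>R ell \<Psi> E (\<phi> j)"
  have X: "subspace (X j)" "X j \<subseteq> eigenspace E \<mu>" if "j \<in> {1..h}" for j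
    using assms(5) that by (auto simp: isotypic_decomposition_def subrep_def)
  note ell_sum = ell_multiplicity_free_sum[OF assms(1,3) finite_atLeastAtMost
      multiplicity_one_components[OF assms(3,5,6)] assms(7)]
  have K_comb: "\<exists>c. (\<forall>j. c j \<ge> 0) \<and> y = ?comb c" if y: "y \<in> ?K" for y
  proof -
    obtain w where w: "w \<in> eigenspace E \<mu>" "y = ell \<Psi> E w" using y by blast
    obtain x where x: "x \<in> Pi\<^sub>E {1..h} X" "w = (\<Sum>j\<in>{1..h}. x j)"
      using assms(5) w(1) unfolding isotypic_decomposition_def by blast
    have "y = ?comb (\<lambda>j. (norm (x j) / norm (\<phi> j))\<^sup>2)"
      unfolding w(2) x(2) using x(1) by (intro ell_sum) (auto simp: PiE_iff)
    then show ?thesis by (intro exI[of _ "\<lambda>j. (norm (x j) / norm (\<phi> j))\<^sup>2"]) simp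
  qed
  have sE: "subspace (eigenspace E \<mu>)"
    unfolding subspace_def eigenspace_def
    by (simp add: matrix_vector_right_distrib matrix_vector_mult_scaleR scaleR_right_distrib)
  have comb_K: "?comb c \<in> ?K" if c: "\<forall>j. c j \<ge> 0" for c
  proof (rule image_eqI)
    let ?x = "\<lambda>j. sqrt (c j) *\<^sub>R \<phi> j"
    have "ell \<Psi> E (\<Sum>j\<in>{1..h}. ?x j) = ?comb (\<lambda>j. (norm (?x j) / norm (\<phi> j))\<^sup>2)"
    proof (rule ell_sum)
      show "?x j \<in> X j" if "j \<in> {1..h}" for j
        using assms(7) that by (intro subspace_scale X(1)) auto
    qed
    also have "\<dots> = ?comb c"
      using assms(7) c by (intro sum.cong refl) (simp add: power_divide power_mult_distrib)
    finally show "?comb c = ell \<Psi> E (\<Sum>j\<in>{1..h}. ?x j)" ..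
    show "(\<Sum>j\<in>{1..h}. ?x j) \<in> eigenspace E \<mu>"
      using assms(7) X(2) sE by (intro subspace_sum) (auto intro!: subspace_scale)
  qed
  have "convex_cone ?K"
    unfolding convex_cone_iff
  proof (intro conjI ballI allI impI)
    show "0 \<in> ?K" using comb_K[of "\<lambda>_. 0"] by simp
    show "x + y \<in> ?K" if xy: "x \<in> ?K" "y \<in> ?K" for x y
    proof -
      obtain c d where "\<forall>j. c j \<ge> 0" "x = ?comb c" "\<forall>j. d j \<ge> 0" "y = ?comb d"
        using K_comb[OF xy(1)] K_comb[OF xy(2)] by blast
      then show ?thesis
        using comb_K[of "\<lambda>j. c j + d j"] by (simp add: scaleR_left_distrib sum.distrib)
    qed
    show "r *\<^sub>R x \<in> ?K" if x: "x \<in> ?K" and r: "0 \<le> r" for x r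
    proof -
      obtain c where "\<forall>j. c j \<ge> 0" "x = ?comb c" using K_comb[OF x] by blast
      then show ?thesis
        using comb_K[of "\<lambda>j. r * c j"] r by (simp add: scaleR_right.sum)
    qed
  qed
  moreover have "?S \<subseteq> ?K" using assms(7) X(2) by blast
  ultimately have "convex_cone hull ?S \<subseteq> ?K" by (intro hull_minimal)
  moreover have "?K \<subseteq> convex_cone hull ?S"
  proof
    fix y assume "y \<in> ?K"
    then obtain c where c: "\<forall>j. c j \<ge> 0" "y = ?comb c" using K_comb by blast
    show "y \<in> convex_cone hull ?S"
      unfolding c(2) by (rule convex_cone_hull_sum) (use c(1) in auto)
  qed
  ultimately have eq: "?K = convex_cone hull ?S" by blast
  have "polyhedron ?K"
    unfolding eq by (rule polyhedron_convex_cone_hull) simp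
  then show ?thesis
    using \<open>convex_cone ?K\<close> eq by (simp add: polyhedral_cone_def Cone_eq_convex_cone_hull)
qed

end
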